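(* Let $k\ge 1$ be an integer and let \[S_k(z)=\sum_{j=0}^k E_{2j} E_{2k-2j} \binom{2k}{2j} z^{j}.\] Then all of the zeros of $S_k(z)$ lie on the unit circle $|z|=1$, and all of the zeros are simple.
   Context: $E_n$ denotes the $n$th Euler number, defined by $\dfrac{2}{e^t+e^{-t}}=\sum_{n\ge 0}E_n\dfrac{t^n}{n!}$ (so $E_0=1$, $E_2=-1$, $E_4=5,\dots$). *)

theory Defs
  imports Complex_Main "HOL-Computational_Algebra.Computational_Algebra"
begin

definition euler_number :: "nat \<Rightarrow> real" where
  "euler_number n = fact n * fps_nth (2 / (fps_exp 1 + fps_exp (-1))) n"

definition S_poly :: "nat \<Rightarrow> complex poly" where
  "S_poly k = (\<Sum>j=0..k. monom
     (of_real (euler_number (2 * j) * euler_number (2 * k - 2 * j)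
        * of_nat ((2 * k) choose (2 * j)))) j)"

end

theory Submission
  imports Defs "HOL-Analysis.Complex_Transcendental"
begin

text \<open>
  Put $b_j = \frac{\pi}{4} (-1)^j (\pi/2)^{2j} E_{2j}/(2j)!$. Up to a common nonzero factor the $j$-th
  coefficient of $S_k$ is $b_j b_{k-j}$, and $b_j$ tends rapidly to 1, so $S_k$ is a small perturbation
  of a multiple of $1 + z + \dots + z^k$: with $C = b_k^2$ one has $\sum_j |C - b_j b_{k-j}| < C$.
  For a real self-reciprocal polynomial this inequality forces the real function
  $e^{-ikx/2} S_k(e^{ix})$ to alternate in sign at the $k+1$ points $(2m+1)\pi/(k+1)$, which yields
  $k$ distinct zeros on the unit circle.

  To estimate $b_j$, let $x$ be a formal variable: $\sum_j b_j x^j = (\pi/4)/\cos(\frac{\pi}{2}\sqrt{x})$.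
  Cancelling the pole at $x = 1$ shows that the differences $d_j = b_j - b_{j-1}$ have generating
  function $(\pi/4) / \sum_i p_i x^i$, where $p_i$ is the $i$-th partial sum of the cosine series
  at $\pi/2$. Since $\cos(\pi/2) = 0$, the $p_i$ decay very fast, and this bounds
  $\sum_j |d_j|$ and $\sum_j j |d_j|$.
\<close>

section \<open>Self-reciprocal polynomials with nearly constant coefficients\<close>

text \<open>The product-to-sum formula makes the sum telescope. The shift \<open>a\<close> stays
  independent of \<open>n\<close> so that induction on \<open>n\<close> applies; only afterwards is
  it set to half the upper index, where the two sines coincide.\<close>

lemma sin_mult_sum_cos_shift:
  fixes x a :: real
  shows "2 * sin (x / 2) * (\<Sum>j=0..n. cos ((real j - a) * x))
         = sin ((real n + 1/2 - a) * x) + sin ((1/2 + a) * x)"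
proof (induction n)
  case 0
  have "sin ((1/2 - a) * x) = sin (x/2 - a * x)" "sin ((1/2 + a) * x) = sin (x/2 + a * x)"
    by (simp_all add: algebra_simps)
  then show ?case
    by (simp add: sin_add sin_diff)
next
  case (Suc n)
  have "sin ((real (Suc n) + 1/2 - a) * x) = sin ((real (Suc n) - a) * x + x / 2)"
       "sin ((real n + 1/2 - a) * x) = sin ((real (Suc n) - a) * x - x / 2)"
    by (simp_all add: field_simps)
  then have "2 * sin (x / 2) * cos ((real (Suc n) - a) * x)
      = sin ((real (Suc n) + 1/2 - a) * x) - sin ((real n + 1/2 - a) * x)"
    by (simp add: sin_add sin_diff)
  with Suc show ?case
    by (simp add: distrib_left)
qed

lemma sin_mult_sum_cos_centred:
  "sin (x / 2) * (\<Sum>j=0..k. cos ((real j - real k / 2) * x)) = sin (real (k + 1) * x / 2)"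
proof -
  have "(real k + 1/2 - real k / 2) * x = real (k + 1) * x / 2"
       "(1/2 + real k / 2) * x = real (k + 1) * x / 2"
    by (simp_all add: field_simps)
  then have "2 * sin (x / 2) * (\<Sum>j=0..k. cos ((real j - real k / 2) * x))
      = sin (real (k + 1) * x / 2) + sin (real (k + 1) * x / 2)"
    using sin_mult_sum_cos_shift[of x "real k / 2" k] by (simp only:)
  then show ?thesis by simp
qed

text \<open>Once \<open>cis (k x / 2)\<close> is factored out, the frequencies j - k/2 change sign
  under j -> k - j. By the symmetry of \<open>c\<close> the sine part \<open>t\<close> then equals
  its own negative, so the remaining factor is real.\<close>

lemma poly_self_reciprocal_cis:
  fixes c :: "nat \<Rightarrow> real"
  assumes sym: "\<And>j. j \<le> k \<Longrightarrow> c (k - j) = c j"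
  shows "poly (\<Sum>j=0..k. monom (complex_of_real (c j)) j) (cis x)
         = cis (real k * x / 2) * of_real (\<Sum>j=0..k. c j * cos ((real j - real k / 2) * x))"
proof -
  define t where "t = (\<Sum>j=0..k. c j * sin ((real j - real k / 2) * x))"
  have "t = (\<Sum>j=0..k. c (k - j) * sin ((real (k - j) - real k / 2) * x))"
    unfolding t_def by (rule sum.atLeastAtMost_rev[of _ 0 k, simplified])
  also have "\<dots> = (\<Sum>j=0..k. - (c j * sin ((real j - real k / 2) * x)))"
  proof (rule sum.cong)
    fix j assume j: "j \<in> {0..k}"
    have "(real (k - j) - real k / 2) * x = - ((real j - real k / 2) * x)"
      using j by (simp add: of_nat_diff field_simps)
    then show "c (k - j) * sin ((real (k - j) - real k / 2) * x)
        = - (c j * sin ((real j - real k / 2) * x))"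
      using j sym by simp
  qed simp
  also have "\<dots> = - t"
    by (simp add: t_def sum_negf)
  finally have t: "t = 0" by simp
  have "poly (\<Sum>j=0..k. monom (complex_of_real (c j)) j) (cis x)
      = (\<Sum>j=0..k. of_real (c j) * cis (real j * x))"
    by (simp add: poly_sum poly_monom Complex.DeMoivre)
  also have "\<dots> = (\<Sum>j=0..k. cis (real k * x / 2) * (of_real (c j) * cis ((real j - real k / 2) * x)))"
    by (intro sum.cong) (simp_all add: cis_mult field_simps)
  also have "\<dots> = cis (real k * x / 2) * (\<Sum>j=0..k. of_real (c j) * cis ((real j - real k / 2) * x))"
    by (simp add: sum_distrib_left)
  also have "(\<Sum>j=0..k. of_real (c j) * cis ((real j - real k / 2) * x))
      = complex_of_real (\<Sum>j=0..k. c j * cos ((real j - real k / 2) * x))"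
    using t by (simp add: complex_eq_iff t_def)
  finally show ?thesis .
qed

section \<open>Locating and counting zeros\<close>

lemma IVT_sign_change:
  fixes f :: "real \<Rightarrow> real"
  assumes "a < b" "continuous_on {a..b} f" "f a * f b < 0"
  obtains x where "a < x" "x < b" "f x = 0"
proof -
  from assms(3) have "f a < 0 \<and> f b > 0 \<or> f a > 0 \<and> f b < 0"
    by (auto simp: mult_less_0_iff)
  then obtain x where "a \<le> x" "x \<le> b" "f x = 0"
    using IVT'[of f a 0 b] IVT2'[of f b 0 a] assms(1,2) by (metis less_imp_le)
  moreover have "f a \<noteq> 0" "f b \<noteq> 0"
    using assms(3) by auto
  ultimately show ?thesis
    by (metis that less_le)
qed

text \<open>The multiplicities of all roots add up to at most the degree, hence to at most
  \<open>card A\<close>. Since each root contributes at least 1, \<open>A\<close> exhausts the roots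
  and no multiplicity can exceed 1.\<close>

lemma order_eq_1_of_card_roots:
  fixes p :: "'a::idom poly"
  assumes "p \<noteq> 0" "degree p \<le> card A" "\<And>x. x \<in> A \<Longrightarrow> poly p x = 0" "poly p z = 0"
  shows "z \<in> A \<and> order z p = 1"
proof -
  let ?R = "{x. poly p x = 0}"
  have fin: "finite ?R"
    using assms(1) by (rule poly_roots_finite)
  have AR: "A \<subseteq> ?R"
    using assms(3) by auto
  have card: "card ?R = card A"
    using card_poly_roots_bound[OF assms(1)] card_mono[OF fin AR] assms(2) by linarith
  have A: "A = ?R"
    using card_subset_eq[OF fin AR] card by simp
  have pos: "order x p \<ge> 1" if "x \<in> ?R" for x
    using that assms(1) by (simp add: order_root Suc_le_eq)
  have "order z p + card (?R - {z}) \<le> order z p + (\<Sum>x\<in>?R - {z}. order x p)"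
    using sum_mono[of "?R - {z}" "\<lambda>_. 1" "\<lambda>x. order x p"] pos by simp
  also have "\<dots> = (\<Sum>x\<in>?R. order x p)"
    using assms(4) fin by (simp add: sum.remove)
  also have "\<dots> \<le> card ?R"
    using sum_order_le_degree[OF assms(1)] assms(2) card by linarith
  also have "\<dots> = 1 + card (?R - {z})"
    using card.remove[OF fin, of z] assms(4) by simp
  finally have "order z p \<le> 1" by simp
  with pos[of z] assms(4) A show ?thesis by auto
qed

lemma cis_neq_cis:
  assumes "x < y" "y - x < 2 * pi"
  shows "cis x \<noteq> cis y"
proof
  assume "cis x = cis y"
  then have "cis (y - x) = 1"
    by (simp flip: cis_divide)
  then have "cos (y - x) = 1"
    by (simp add: complex_eq_iff)
  then obtain n :: int where n: "y - x = n * 2 * pi"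
    by (auto simp: cos_one_2pi_int)
  with assms have "0 < of_int n * (2 * pi)" "of_int n * (2 * pi) < 1 * (2 * pi)"
    by linarith+
  then have "0 < n" "n < 1"
    by (simp_all add: zero_less_mult_iff)
  then show False by simp
qed

text \<open>At the points $x = (2m+1)\pi/(k+1)$ the kernel \<open>sin ((k+1)x/2)\<close> equals $\pm 1$ with alternating
  signs, and the perturbation of the coefficients is too small to change these signs.\<close>
lemma self_reciprocal_roots_on_circle:
  fixes c :: "nat \<Rightarrow> real"
  assumes sym: "\<And>j. j \<le> k \<Longrightarrow> c (k - j) = c j"
    and small: "(\<Sum>j=0..k. \<bar>C - c j\<bar>) < \<bar>C\<bar>"
    and root: "poly (\<Sum>j=0..k. monom (complex_of_real (c j)) j) z = 0"
  shows "cmod z = 1 \<and> order z (\<Sum>j=0..k. monom (complex_of_real (c j)) j) = 1"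
proof -
  define p where "p = (\<Sum>j=0..k. monom (complex_of_real (c j)) j)"
  define F where "F = (\<lambda>x. \<Sum>j=0..k. c j * cos ((real j - real k / 2) * x))"
  define \<phi> where "\<phi> = (\<lambda>m::nat. (2 * real m + 1) * pi / real (k + 1))"
  have p_cis: "poly p (cis x) = cis (real k * x / 2) * of_real (F x)" for x
    unfolding p_def F_def by (rule poly_self_reciprocal_cis) (rule sym)
  have \<phi>_mono: "\<phi> m < \<phi> n" if "m < n" for m n
    using that by (simp add: \<phi>_def divide_strict_right_mono)
  have \<phi>_pos: "\<phi> m > 0" for m
    by (simp add: \<phi>_def field_simps add_pos_nonneg)
  have \<phi>_less: "\<phi> m < 2 * pi" if "m \<le> k" for m
  proof -
    have "(2 * real m + 1) * pi < (2 * real (k + 1)) * pi"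
      using that by (intro mult_strict_right_mono) auto
    then show ?thesis by (simp add: \<phi>_def field_simps)
  qed
  have sign: "0 < C * (-1) ^ m * F (\<phi> m)" if "m \<le> k" for m
  proof -
    let ?x = "\<phi> m"
    define e :: real where "e = (-1) ^ m"
    have e: "e * e = 1" "\<bar>e\<bar> = 1"
      by (simp_all add: e_def power_abs flip: power_mult_distrib)
    let ?s = "sin (?x / 2)"
    have s: "?s > 0"
      using \<phi>_pos[of m] \<phi>_less[OF that] by (intro sin_gt_zero) auto
    have "real (k + 1) * ?x / 2 = real m * pi + pi / 2"
      by (simp add: \<phi>_def field_simps)
    then have "sin (real (k + 1) * ?x / 2) = sin (real m * pi + pi / 2)"
      by (simp only:)
    also have "\<dots> = e"
      by (simp only: sin_add) (simp add: e_def)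
    finally have "sin (real (k + 1) * ?x / 2) = e" .
    then have K: "?s * (\<Sum>j=0..k. cos ((real j - real k / 2) * ?x)) = e"
      using sin_mult_sum_cos_centred[of ?x k] by simp
    have "\<bar>\<Sum>j=0..k. (C - c j) * cos ((real j - real k / 2) * ?x)\<bar>
        \<le> (\<Sum>j=0..k. \<bar>C - c j\<bar> * 1)"
      by (intro order.trans[OF sum_abs] sum_mono)
         (auto simp: abs_mult intro!: mult_left_le)
    then have E: "\<bar>\<Sum>j=0..k. (C - c j) * cos ((real j - real k / 2) * ?x)\<bar> < \<bar>C\<bar>"
      (is "\<bar>?E\<bar> < _") using small by simp
    have "?s * \<bar>?E\<bar> \<le> 1 * \<bar>?E\<bar>"
      by (intro mult_right_mono) auto
    with s E have sE: "\<bar>?s * ?E\<bar> < \<bar>C\<bar>"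
      by (simp add: abs_mult)
    \<comment> \<open>Constant coefficients C would give the pure kernel; \<open>?E\<close> collects
      the deviation. Multiplying by \<open>?s\<close>, which lies in (0,1], turns the kernel into
      \<open>e\<close> = +-1, and the deviation stays below |C|, so \<open>F ?x\<close> has the sign
      of \<open>C * e\<close>.\<close>
    have "F ?x = C * (\<Sum>j=0..k. cos ((real j - real k / 2) * ?x)) - ?E"
      by (simp add: F_def sum_distrib_left left_diff_distrib sum_subtractf)
    then have "?s * F ?x = C * (?s * (\<Sum>j=0..k. cos ((real j - real k / 2) * ?x))) - ?s * ?E"
      by (simp only: right_diff_distrib mult.left_commute)
    then have "?s * F ?x = C * e - ?s * ?E"
      by (simp only: K)
    then have "C * e * (?s * F ?x) = C * e * (C * e) - C * e * (?s * ?E)"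
      by (simp only: right_diff_distrib)
    also have "C * e * (C * e) = C * C"
      using e(1) by (metis mult.assoc mult.commute mult.right_neutral)
    finally have "C * e * (?s * F ?x) = C * C - C * e * (?s * ?E)" .
    moreover have "\<bar>C * e * (?s * ?E)\<bar> < C * C"
    proof -
      have "\<bar>C\<bar> * \<bar>?s * ?E\<bar> < \<bar>C\<bar> * \<bar>C\<bar>"
        using sE by (intro mult_strict_left_mono) auto
      then show ?thesis by (simp only: abs_mult e abs_mult_self_eq mult_1_right)
    qed
    ultimately have "0 < C * e * (?s * F ?x)"
      by linarith
    then have "0 < ?s * (C * e * F ?x)"
      by (simp only: mult_ac)
    with s show ?thesis
      by (simp add: zero_less_mult_iff e_def)
  qed
  have "\<exists>x. \<phi> m < x \<and> x < \<phi> (Suc m) \<and> F x = 0" if "m < k" for m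
  proof -
    have "0 < (C * (-1) ^ m * F (\<phi> m)) * (C * (-1) ^ Suc m * F (\<phi> (Suc m)))"
      using that by (intro mult_pos_pos[OF sign sign]) auto
    also have "\<dots> = ((-1) ^ m * (-1) ^ m) * (C * C) * - (F (\<phi> m) * F (\<phi> (Suc m)))"
      by (simp add: mult_ac)
    also have "(-1) ^ m * (-1) ^ m = (1::real)"
      by (simp flip: power_mult_distrib)
    finally have "F (\<phi> m) * F (\<phi> (Suc m)) < 0"
      using zero_le_square[of C] by (auto simp: zero_less_mult_iff mult_less_0_iff)
    moreover have "continuous_on {\<phi> m..\<phi> (Suc m)} F"
      unfolding F_def by (intro continuous_intros)
    ultimately show ?thesis
      using IVT_sign_change[of "\<phi> m" "\<phi> (Suc m)" F] \<phi>_mono[of m "Suc m"] by blast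
  qed
  then obtain r where r: "\<And>m. m < k \<Longrightarrow> \<phi> m < r m \<and> r m < \<phi> (Suc m) \<and> F (r m) = 0"
    by metis
  have r_less: "r m < r n" if "m < n" "n < k" for m n
  proof -
    have "\<phi> (Suc m) \<le> \<phi> n"
      using \<phi>_mono[of "Suc m" n] that by (cases "Suc m = n") auto
    with r[of m] r[of n] that show ?thesis by simp
  qed
  \<comment> \<open>All the zeros lie between \<open>\<phi> 0\<close> > 0 and
    \<open>\<phi> k\<close> < 2 pi, that is, within one period, so distinct arguments give distinct
    points of the circle.\<close>
  have inj: "inj_on (\<lambda>m. cis (r m)) {..<k}"
  proof (rule linorder_inj_onI)
    fix m n assume mn: "m < n" "m \<in> {..<k}" "n \<in> {..<k}"
    have "r m < r n" "0 < r m" "r n < 2 * pi"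
      using r_less[of m n] r[of m] r[of n] mn \<phi>_pos[of m] \<phi>_less[of "Suc n"] by auto
    then show "cis (r m) \<noteq> cis (r n)"
      by (intro cis_neq_cis) auto
  qed auto
  define A where "A = (\<lambda>m. cis (r m)) ` {..<k}"
  have "card A = k"
    using inj by (simp add: A_def card_image)
  moreover have "degree p \<le> k"
    unfolding p_def by (intro degree_sum_le) (auto intro: order.trans[OF degree_monom_le])
  moreover have "p \<noteq> 0"
    using p_cis[of "\<phi> 0"] sign[of 0] by auto
  moreover have "poly p x = 0" if "x \<in> A" for x
    using that r by (auto simp: A_def p_cis)
  ultimately have "z \<in> A \<and> order z p = 1"
    using root by (intro order_eq_1_of_card_roots) (auto simp: p_def)
  then show ?thesis
    by (auto simp: A_def p_def)
qed

section \<open>Estimates for the Euler numbers\<close>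

lemma sum_even_indices:
  fixes f :: "nat \<Rightarrow> 'a::comm_monoid_add"
  assumes "\<And>i. odd i \<Longrightarrow> i \<le> 2 * n \<Longrightarrow> f i = 0"
  shows "(\<Sum>i=0..2*n. f i) = (\<Sum>i=0..n. f (2 * i))"
  using assms by (induction n) auto

text \<open>Compares the coefficients of t^(2j) in G(t) (e^t + e^(-t)) = 2. The second factor has no
  odd coefficients and even ones 2/(2i)!, so only even-indexed coefficients of G enter.\<close>

lemma euler_fps_even_recurrence:
  fixes G :: "real fps"
  defines "G \<equiv> 2 / (fps_exp 1 + fps_exp (-1))"
  shows "(\<Sum>i=0..j. fps_nth G (2 * i) / fact (2 * (j - i))) = (if j = 0 then 1 else 0)"
proof -
  define H :: "real fps" where "H = fps_exp 1 + fps_exp (-1)"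
  have H: "fps_nth H n = (1 + (-1) ^ n) / fact n" for n
    by (simp add: H_def add_divide_distrib)
  have "G * H = 2"
    using H[of 0] by (simp add: G_def fps_divide_unit mult.assoc inverse_mult_eq_1 flip: H_def)
  then have "(\<Sum>i=0..2*j. fps_nth G i * fps_nth H (2 * j - i)) = fps_nth 2 (2 * j)"
    by (metis fps_mult_nth)
  also have "(\<Sum>i=0..2*j. fps_nth G i * fps_nth H (2 * j - i))
      = (\<Sum>i=0..j. fps_nth G (2 * i) * fps_nth H (2 * j - 2 * i))"
    by (intro sum_even_indices) (simp add: H)
  also have "\<dots> = 2 * (\<Sum>i=0..j. fps_nth G (2 * i) / fact (2 * (j - i)))"
    unfolding sum_distrib_left
    by (intro sum.cong) (auto simp: H simp flip: right_diff_distrib')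
  finally show ?thesis
    by (auto simp: numeral_fps_const split: if_splits)
qed

section \<open>Decay of the partial sums of the cosine series at pi/2\<close>

definition cos_partial :: "nat \<Rightarrow> real" where
  "cos_partial n = (\<Sum>l=0..n. (-1) ^ l * (pi / 2) ^ (2 * l) / fact (2 * l))"

text \<open>Since cos(pi/2) = 0, the partial sum is minus the Taylor remainder. The coefficient at
  2n+1 vanishes, so the expansion may be taken to order 2n+2, which gives the sharper
  remainder.\<close>

lemma abs_cos_partial_le: "\<bar>cos_partial n\<bar> \<le> (pi / 2) ^ (2 * n + 2) / fact (2 * n + 2)"
proof -
  obtain t where t: "cos (pi / 2) = (\<Sum>m<2*n+2. cos_coeff m * (pi / 2) ^ m)
      + (cos (t + 1/2 * real (2*n+2) * pi) / fact (2*n+2)) * (pi / 2) ^ (2*n+2)"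
    using Maclaurin_cos_expansion2[of "pi / 2" "2*n+2"] by auto
  have "{..<2*n+2} = insert (2 * n + 1) {0..2*n}"
    by auto
  then have "(\<Sum>m<2*n+2. cos_coeff m * (pi / 2) ^ m) = (\<Sum>m=0..2*n. cos_coeff m * (pi / 2) ^ m)"
    by (simp add: cos_coeff_def)
  also have "\<dots> = cos_partial n"
    by (subst sum_even_indices) (simp_all add: cos_coeff_def cos_partial_def)
  finally have "cos_partial n = - ((cos (t + 1/2 * real (2*n+2) * pi) / fact (2*n+2)) * (pi / 2) ^ (2*n+2))"
    using t by simp
  then have "\<bar>cos_partial n\<bar>
      = \<bar>cos (t + 1/2 * real (2*n+2) * pi)\<bar> * ((pi / 2) ^ (2*n+2) / fact (2*n+2))"
    by (simp only: abs_minus_cancel abs_mult abs_divide power_abs) simp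
  also have "\<dots> \<le> 1 * ((pi / 2) ^ (2*n+2) / fact (2*n+2))"
    by (intro mult_right_mono abs_cos_le_one) simp
  finally show ?thesis by simp
qed

lemma pi_half_squared_le: "(pi / 2)\<^sup>2 \<le> 24675 / 10000"
proof -
  have "(pi / 2)\<^sup>2 \<le> (15708 / 10000)\<^sup>2"
    using pi_approx by (intro power_mono) auto
  then show ?thesis by (simp add: power2_eq_square)
qed

lemma pi_half_squared_ge: "24649 / 10000 \<le> (pi / 2)\<^sup>2"
proof -
  have "(157 / 100)\<^sup>2 \<le> (pi / 2)\<^sup>2"
    using pi_approx by (intro power_mono) auto
  then show ?thesis by (simp add: power2_eq_square)
qed

lemma cos_partial_0: "cos_partial 0 = 1"
  by (simp add: cos_partial_def)

lemma cos_partial_1: "cos_partial 1 = 1 - (pi / 2)\<^sup>2 / 2"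
  by (simp add: cos_partial_def)

lemma cos_partial_tail: "\<bar>cos_partial (n + 2)\<bar> \<le> (21 / 1000) / 20 ^ n"
proof -
  define a :: "nat \<Rightarrow> real" where "a n = (pi / 2) ^ (2 * (n + 2) + 2) / fact (2 * (n + 2) + 2)" for n
  \<comment> \<open>The constant 0.021 lies just above (pi/2)^6/720, and consecutive terms have
    ratio at most 2.4675/56 < 1/20.\<close>
  have "a n \<le> (21 / 1000) / 20 ^ n"
  proof (induction n)
    case 0
    have "((pi / 2)\<^sup>2) ^ 3 \<le> (24675 / 10000) ^ 3"
      by (intro power_mono pi_half_squared_le) simp
    then have "(pi / 2) ^ 6 \<le> (24675 / 10000) ^ 3"
      by (simp flip: power_mult)
    moreover have "a 0 = (pi / 2) ^ 6 / 720"
      by (simp add: a_def fact_numeral)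
    ultimately show ?case
      by (simp add: power3_eq_cube)
  next
    case (Suc n)
    have "a (Suc n) = a n * ((pi / 2)\<^sup>2 / (real (2 * n + 7) * real (2 * n + 8)))"
      by (simp add: a_def power2_eq_square field_simps)
    also have "\<dots> \<le> a n * (1 / 20)"
    proof (intro mult_left_mono)
      have "56 \<le> real (2 * n + 7) * real (2 * n + 8)"
        using mult_mono[of 7 "real (2 * n + 7)" 8 "real (2 * n + 8)"] by simp
      then have "(pi / 2)\<^sup>2 / (real (2 * n + 7) * real (2 * n + 8)) \<le> (24675 / 10000) / 56"
        by (intro frac_le pi_half_squared_le) auto
      then show "(pi / 2)\<^sup>2 / (real (2 * n + 7) * real (2 * n + 8)) \<le> 1 / 20" by linarith
    qed (simp add: a_def)
    also have "\<dots> \<le> (21 / 1000) / 20 ^ n * (1 / 20)"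
      by (intro mult_right_mono Suc) simp
    finally show ?case by simp
  qed
  with abs_cos_partial_le[of "n + 2"] show ?thesis
    by (simp add: a_def)
qed

text \<open>The subtracted term makes the bound inductive, with 0.0222 - 0.0012 = 0.021 at the
  start. The total 0.0222 leaves a little room above the geometric sum 0.021 * 20/19.\<close>

lemma sum_cos_partial_tail: "(\<Sum>i=2..n+2. \<bar>cos_partial i\<bar>) \<le> (222 / 10000) - (12 / 10000) / 20 ^ n"
proof (induction n)
  case 0
  show ?case using cos_partial_tail[of 0] by simp
next
  case (Suc n)
  have "(\<Sum>i=2..Suc n+2. \<bar>cos_partial i\<bar>) = (\<Sum>i=2..n+2. \<bar>cos_partial i\<bar>) + \<bar>cos_partial (Suc n + 2)\<bar>"
    by simp
  also have "\<dots> \<le> ((222 / 10000) - (12 / 10000) / 20 ^ n) + (21 / 1000) / 20 ^ Suc n"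
    by (intro add_mono Suc cos_partial_tail)
  also have "\<dots> \<le> (222 / 10000) - (12 / 10000) / 20 ^ Suc n"
    by (simp add: field_simps)
  finally show ?case .
qed

lemma sum_weighted_cos_partial_tail:
  "(\<Sum>i=2..n+2. real i * \<bar>cos_partial i\<bar>) \<le> (47 / 1000) - (47 / 10000) / 10 ^ n"
proof (induction n)
  case 0
  show ?case using cos_partial_tail[of 0] by simp
next
  case (Suc n)
  \<comment> \<open>The linear weight is absorbed by m + 2 <= 2 * 2^m, which weakens the decay rate
    from 1/20 to 1/10.\<close>
  have w: "real (Suc n + 2) * \<bar>cos_partial (Suc n + 2)\<bar> \<le> (42 / 1000) / 10 ^ Suc n"
  proof -
    have "m + 2 \<le> 2 * 2 ^ m" for m :: nat
      by (induction m) auto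
    then have "real (Suc n + 2) \<le> real (2 * 2 ^ Suc n)"
      by (rule of_nat_mono)
    then have "real (Suc n + 2) * \<bar>cos_partial (Suc n + 2)\<bar> \<le> (2 * 2 ^ Suc n) * ((21 / 1000) / 20 ^ Suc n)"
      by (intro mult_mono cos_partial_tail) auto
    also have "(20::real) ^ Suc n = 2 ^ Suc n * 10 ^ Suc n"
      by (simp flip: power_mult_distrib)
    finally show ?thesis by simp
  qed
  have "(\<Sum>i=2..Suc n+2. real i * \<bar>cos_partial i\<bar>)
      = (\<Sum>i=2..n+2. real i * \<bar>cos_partial i\<bar>) + real (Suc n + 2) * \<bar>cos_partial (Suc n + 2)\<bar>"
    by simp
  also have "\<dots> \<le> ((47 / 1000) - (47 / 10000) / 10 ^ n) + (42 / 1000) / 10 ^ Suc n"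
    by (intro add_mono Suc w)
  also have "\<dots> \<le> (47 / 1000) - (47 / 10000) / 10 ^ Suc n"
    by (simp add: field_simps)
  finally show ?case .
qed

lemma sum_cos_partial_tail_le: "(\<Sum>i=2..N. \<bar>cos_partial i\<bar>) \<le> 222 / 10000"
proof (cases "N \<ge> 2")
  case True
  then obtain n where "N = n + 2" by (metis le_add_diff_inverse2)
  with sum_cos_partial_tail[of n] show ?thesis
    by (smt (verit) divide_nonneg_nonneg zero_le_power)
qed simp

lemma sum_weighted_cos_partial_tail_le: "(\<Sum>i=2..N. real i * \<bar>cos_partial i\<bar>) \<le> 47 / 1000"
proof (cases "N \<ge> 2")
  case True
  then obtain n where "N = n + 2" by (metis le_add_diff_inverse2)
  with sum_weighted_cos_partial_tail[of n] show ?thesis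
    by (smt (verit) divide_nonneg_nonneg zero_le_power)
qed simp

text \<open>This term dominates and is kept apart from the geometric tail. The next two bounds come
  from 0.2338 + 0.0222 = 0.256 and 0.2338 + 0.047 < 0.281.\<close>

lemma abs_cos_partial_1_le: "\<bar>cos_partial 1\<bar> \<le> 2338 / 10000"
  using pi_half_squared_le pi_half_squared_ge unfolding cos_partial_1 by linarith

lemma sum_cos_partial_le: "(\<Sum>i=1..N. \<bar>cos_partial i\<bar>) \<le> 256 / 1000"
proof (cases N)
  case (Suc M)
  then have "(\<Sum>i=1..N. \<bar>cos_partial i\<bar>) = \<bar>cos_partial 1\<bar> + (\<Sum>i=2..N. \<bar>cos_partial i\<bar>)"
    by (subst sum.atLeast_Suc_atMost) (auto simp: numeral_2_eq_2)
  with abs_cos_partial_1_le sum_cos_partial_tail_le[of N] show ?thesis by linarith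
qed simp

lemma sum_weighted_cos_partial_le: "(\<Sum>i=1..N. real i * \<bar>cos_partial i\<bar>) \<le> 281 / 1000"
proof (cases N)
  case (Suc M)
  then have "(\<Sum>i=1..N. real i * \<bar>cos_partial i\<bar>)
      = \<bar>cos_partial 1\<bar> + (\<Sum>i=2..N. real i * \<bar>cos_partial i\<bar>)"
    by (subst sum.atLeast_Suc_atMost) (auto simp: numeral_2_eq_2)
  with abs_cos_partial_1_le sum_weighted_cos_partial_tail_le[of N] show ?thesis by linarith
qed simp

section \<open>Bounds for the coefficients of a reciprocal power series\<close>

lemma sum_convolution_le:
  fixes q x :: "nat \<Rightarrow> real"
  assumes "\<And>i. q i \<ge> 0" "\<And>i. x i \<ge> 0"
  shows "(\<Sum>n\<le>N. \<Sum>i\<le>n. q i * x (n - i)) \<le> (\<Sum>i\<le>N. q i) * (\<Sum>i\<le>N. x i)"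
proof -
  have "(\<Sum>n\<le>N. \<Sum>i\<le>n. q i * x (n - i)) = (\<Sum>(i,j)\<in>{(i,j). i + j \<le> N}. q i * x j)"
    by (rule sum.triangle_reindex_eq[symmetric])
  \<comment> \<open>The triangle i + j <= N lies inside the square, and all terms are
    nonnegative.\<close>
  also have "\<dots> \<le> (\<Sum>(i,j)\<in>{..N}\<times>{..N}. q i * x j)"
    using assms by (intro sum_mono2) auto
  also have "\<dots> = (\<Sum>i\<le>N. q i) * (\<Sum>i\<le>N. x i)"
    by (simp add: sum_product sum.cartesian_product)
  finally show ?thesis .
qed

text \<open>Solving the convolution for its leading term bounds |d_n| by earlier |d_i| with weights
  of total mass at most Q < 1. Hence T <= |d_0| + Q T and W <= Q' T + Q W for the truncated sums,
  with constants independent of N; being finite, these sums can be moved across the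
  inequalities.\<close>

lemma convolution_inverse_bounds:
  fixes p d :: "nat \<Rightarrow> real"
  assumes p0: "p 0 = 1"
    and conv: "\<And>n. n > 0 \<Longrightarrow> (\<Sum>i\<le>n. p i * d (n - i)) = 0"
    and Q: "\<And>N. (\<Sum>i=1..N. \<bar>p i\<bar>) \<le> Q" "Q < 1"
    and Q': "\<And>N. (\<Sum>i=1..N. real i * \<bar>p i\<bar>) \<le> Q'"
  shows "(\<Sum>n\<le>N. \<bar>d n\<bar>) \<le> \<bar>d 0\<bar> / (1 - Q)"
    and "(\<Sum>n\<le>N. real n * \<bar>d n\<bar>) \<le> Q' * \<bar>d 0\<bar> / (1 - Q)\<^sup>2"
proof -
  define q where "q i = (if i = 0 then 0 else \<bar>p i\<bar>)" for i
  define T where "T = (\<Sum>n\<le>N. \<bar>d n\<bar>)"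
  define W where "W = (\<Sum>n\<le>N. real n * \<bar>d n\<bar>)"
  have q_nonneg: "q i \<ge> 0" for i
    by (simp add: q_def)
  have TW_nonneg: "T \<ge> 0" "W \<ge> 0"
    by (auto simp: T_def W_def intro!: sum_nonneg)
  have d_le: "\<bar>d n\<bar> \<le> (\<Sum>i\<le>n. q i * \<bar>d (n - i)\<bar>)" if "n > 0" for n
  proof -
    have "(\<Sum>i\<le>n. p i * d (n - i)) = d n + (\<Sum>i\<in>{..n}-{0}. p i * d (n - i))"
      by (subst sum.remove[of _ 0]) (auto simp: p0)
    then have "\<bar>d n\<bar> = \<bar>\<Sum>i\<in>{..n}-{0}. p i * d (n - i)\<bar>"
      using conv[OF that] by simp
    also have "\<dots> \<le> (\<Sum>i\<in>{..n}-{0}. q i * \<bar>d (n - i)\<bar>)"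
      by (intro order.trans[OF sum_abs] sum_mono) (auto simp: q_def abs_mult)
    also have "\<dots> \<le> (\<Sum>i\<le>n. q i * \<bar>d (n - i)\<bar>)"
      by (intro sum_mono2) (auto simp: q_nonneg)
    finally show ?thesis .
  qed
  have sum_q: "(\<Sum>i\<le>N. q i) \<le> Q"
  proof -
    have "(\<Sum>i\<le>N. q i) = (\<Sum>i=1..N. \<bar>p i\<bar>)"
      by (intro sum.mono_neutral_cong_right) (auto simp: q_def)
    with Q show ?thesis by simp
  qed
  have sum_q': "(\<Sum>i\<le>N. real i * q i) \<le> Q'"
  proof -
    have "(\<Sum>i\<le>N. real i * q i) = (\<Sum>i=1..N. real i * \<bar>p i\<bar>)"
      by (intro sum.mono_neutral_cong_right) (auto simp: q_def)
    with Q' show ?thesis by simp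
  qed
  \<comment> \<open>Because \<open>q 0 = 0\<close>, the convolution vanishes at n = 0, so |d_0| has
    to be added separately.\<close>
  have "T \<le> (\<Sum>n\<le>N. (if n = 0 then \<bar>d 0\<bar> else 0) + (\<Sum>i\<le>n. q i * \<bar>d (n - i)\<bar>))"
    unfolding T_def
  proof (intro sum_mono)
    fix n show "\<bar>d n\<bar> \<le> (if n = 0 then \<bar>d 0\<bar> else 0) + (\<Sum>i\<le>n. q i * \<bar>d (n - i)\<bar>)"
      using d_le[of n] by (simp add: q_def)
  qed
  also have "\<dots> = \<bar>d 0\<bar> + (\<Sum>n\<le>N. \<Sum>i\<le>n. q i * \<bar>d (n - i)\<bar>)"
    by (simp add: sum.distrib)
  also have "(\<Sum>n\<le>N. \<Sum>i\<le>n. q i * \<bar>d (n - i)\<bar>) \<le> (\<Sum>i\<le>N. q i) * T"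
    unfolding T_def by (intro sum_convolution_le q_nonneg) auto
  also have "\<dots> \<le> Q * T"
    by (intro mult_right_mono sum_q TW_nonneg)
  finally have "T * (1 - Q) \<le> \<bar>d 0\<bar>"
    by (simp add: algebra_simps)
  then have T: "T \<le> \<bar>d 0\<bar> / (1 - Q)"
    using Q(2) by (simp add: field_simps)
  then show "(\<Sum>n\<le>N. \<bar>d n\<bar>) \<le> \<bar>d 0\<bar> / (1 - Q)"
    by (simp add: T_def)
  \<comment> \<open>Writing the weight as n = i + (n - i) puts one part on \<open>q\<close> and the
    other on \<open>d\<close>, as in the product rule.\<close>
  have "W \<le> (\<Sum>n\<le>N. (\<Sum>i\<le>n. (real i * q i) * \<bar>d (n - i)\<bar>)
               + (\<Sum>i\<le>n. q i * (real (n - i) * \<bar>d (n - i)\<bar>)))"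
    unfolding W_def
  proof (intro sum_mono)
    fix n
    have "real n * \<bar>d n\<bar> \<le> real n * (\<Sum>i\<le>n. q i * \<bar>d (n - i)\<bar>)"
      using d_le[of n] by (cases "n = 0") (auto intro: mult_left_mono)
    also have "\<dots> = (\<Sum>i\<le>n. (real i * q i) * \<bar>d (n - i)\<bar> + q i * (real (n - i) * \<bar>d (n - i)\<bar>))"
      unfolding sum_distrib_left by (intro sum.cong) (auto simp: of_nat_diff algebra_simps)
    finally show "real n * \<bar>d n\<bar> \<le> (\<Sum>i\<le>n. (real i * q i) * \<bar>d (n - i)\<bar>)
               + (\<Sum>i\<le>n. q i * (real (n - i) * \<bar>d (n - i)\<bar>))"
      by (simp add: sum.distrib)
  qed
  also have "\<dots> = (\<Sum>n\<le>N. \<Sum>i\<le>n. (real i * q i) * \<bar>d (n - i)\<bar>)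
               + (\<Sum>n\<le>N. \<Sum>i\<le>n. q i * (real (n - i) * \<bar>d (n - i)\<bar>))"
    by (simp add: sum.distrib)
  also have "\<dots> \<le> (\<Sum>i\<le>N. real i * q i) * T + (\<Sum>i\<le>N. q i) * W"
    unfolding T_def W_def
    using sum_convolution_le[of "\<lambda>i. real i * q i" "\<lambda>n. \<bar>d n\<bar>" N]
          sum_convolution_le[of q "\<lambda>n. real n * \<bar>d n\<bar>" N] q_nonneg
    by (intro add_mono) auto
  also have "\<dots> \<le> Q' * T + Q * W"
    by (intro add_mono mult_right_mono sum_q sum_q' TW_nonneg)
  finally have W: "W * (1 - Q) \<le> Q' * T"
    by (simp add: algebra_simps)
  have "Q' \<ge> 0"
    using Q'[of 0] by simp
  then have "Q' * T \<le> Q' * (\<bar>d 0\<bar> / (1 - Q))"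
    by (intro mult_left_mono T)
  with W have "W * (1 - Q) \<le> Q' * (\<bar>d 0\<bar> / (1 - Q))"
    by linarith
  then have "W \<le> Q' * (\<bar>d 0\<bar> / (1 - Q)) / (1 - Q)"
    using Q(2) by (subst pos_le_divide_eq) auto
  then show "(\<Sum>n\<le>N. real n * \<bar>d n\<bar>) \<le> Q' * \<bar>d 0\<bar> / (1 - Q)\<^sup>2"
    by (simp add: W_def power2_eq_square)
qed

section \<open>Rescaled Euler numbers and their generating functions\<close>

text \<open>By the partial fraction expansion of the secant, \<open>beta_ratio n\<close> is the value
  $\beta(2n+1)$ of the Dirichlet beta function; only its approximate size is needed.\<close>
definition beta_ratio :: "nat \<Rightarrow> real" where
  "beta_ratio n = pi / 4 * (-1) ^ n * (pi / 2) ^ (2 * n) * (euler_number (2 * n) / fact (2 * n))"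

text \<open>The case split encodes b_(-1) = 0, so that the generating function is exactly 1 - x
  times that of \<open>beta_ratio\<close>.\<close>

definition beta_diff :: "nat \<Rightarrow> real" where
  "beta_diff n = (if n = 0 then beta_ratio 0 else beta_ratio n - beta_ratio (n - 1))"

lemma beta_ratio_eq_sum: "beta_ratio n = (\<Sum>i\<le>n. beta_diff i)"
  by (induction n) (auto simp: beta_diff_def)

lemma beta_ratio_0: "beta_ratio 0 = pi / 4"
  using euler_fps_even_recurrence[of 0] by (simp add: beta_ratio_def euler_number_def)

text \<open>The powers of -1 and pi/2 split along n = i + (n - i), one share going to each factor.
  The identity is thus the Euler recurrence in rescaled form.\<close>

lemma beta_fps_mult_cos:
  "Abs_fps beta_ratio * Abs_fps (\<lambda>l. (-1) ^ l * (pi / 2) ^ (2 * l) / fact (2 * l)) = fps_const (pi / 4)"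
proof (rule fps_ext)
  fix n
  let ?G = "2 / (fps_exp 1 + fps_exp (-1)) :: real fps"
  have "(\<Sum>i=0..n. beta_ratio i * ((-1) ^ (n - i) * (pi / 2) ^ (2 * (n - i)) / fact (2 * (n - i))))
      = (\<Sum>i=0..n. pi / 4 * (-1) ^ n * (pi / 2) ^ (2 * n) * (fps_nth ?G (2 * i) / fact (2 * (n - i))))"
  proof (intro sum.cong refl)
    fix i assume "i \<in> {0..n}"
    then obtain m where m: "n = i + m"
      by (auto simp: le_iff_add)
    show "beta_ratio i * ((-1) ^ (n - i) * (pi / 2) ^ (2 * (n - i)) / fact (2 * (n - i)))
        = pi / 4 * (-1) ^ n * (pi / 2) ^ (2 * n) * (fps_nth ?G (2 * i) / fact (2 * (n - i)))"
      by (simp add: m beta_ratio_def euler_number_def power_add distrib_left)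
  qed
  also have "\<dots> = pi / 4 * (-1) ^ n * (pi / 2) ^ (2 * n) * (if n = 0 then 1 else 0)"
    by (simp only: euler_fps_even_recurrence flip: sum_distrib_left)
  finally show "fps_nth (Abs_fps beta_ratio * Abs_fps (\<lambda>l. (-1) ^ l * (pi / 2) ^ (2 * l) / fact (2 * l))) n
      = fps_nth (fps_const (pi / 4)) n"
    by (cases "n = 0") (simp_all only: fps_mult_nth fps_nth_Abs_fps fps_nth_fps_const, simp_all)
qed

lemma
  shows cos_partial_beta_diff: "n > 0 \<Longrightarrow> (\<Sum>i\<le>n. cos_partial i * beta_diff (n - i)) = 0"
    and cos_partial_beta_ratio: "(\<Sum>i\<le>n. cos_partial i * beta_ratio (n - i)) = pi / 4"
proof -
  let ?X = "1 - fps_X :: real fps"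
  let ?K = "Abs_fps (\<lambda>l. (-1) ^ l * (pi / 2) ^ (2 * l) / fact (2 * l)) :: real fps"
  let ?P = "Abs_fps cos_partial"
  let ?B = "Abs_fps beta_ratio"
  let ?D = "Abs_fps beta_diff"
  \<comment> \<open>Partial summation is division by 1 - x. Hence P D = P (1 - x) B = K B = pi/4,
    and cancelling 1 - x from (1 - x) P B = pi/4 leaves the constant sequence pi/4 for P B.\<close>
  have K: "?K = ?X * ?P"
    using fps_divide_fps_X_minus1_sum_lemma[of ?K]
    by (simp flip: cos_partial_def)
  have D: "?D = ?X * ?B"
    using fps_divide_fps_X_minus1_sum_lemma[of ?D]
    by (simp flip: beta_ratio_eq_sum atMost_atLeast0)
  have XBP: "?X * (?P * ?B) = fps_const (pi / 4)"
    using beta_fps_mult_cos K by (simp add: mult_ac)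
  then have "?P * ?D = fps_const (pi / 4)"
    using D by (simp add: mult_ac)
  then show "n > 0 \<Longrightarrow> (\<Sum>i\<le>n. cos_partial i * beta_diff (n - i)) = 0"
    by (auto simp: fps_eq_iff fps_mult_nth atMost_atLeast0)
  have "fps_const (pi / 4) = ?X * Abs_fps (\<lambda>n. pi / 4)"
    using fps_divide_fps_X_minus1_sum_lemma[of "fps_const (pi / 4)"] by simp
  with XBP have "?X * (?P * ?B) = ?X * Abs_fps (\<lambda>n. pi / 4)"
    by simp
  moreover have "?X \<noteq> 0"
    by (simp add: fps_eq_iff) (metis zero_neq_one)
  ultimately have "?P * ?B = Abs_fps (\<lambda>n. pi / 4)"
    by (simp only: mult_cancel_left) simp
  then show "(\<Sum>i\<le>n. cos_partial i * beta_ratio (n - i)) = pi / 4"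
    by (simp add: fps_eq_iff fps_mult_nth atMost_atLeast0)
qed

section \<open>Numerical bounds for the rescaled Euler numbers\<close>

lemma sum_abs_beta_diff_le: "(\<Sum>n\<le>N. \<bar>beta_diff n\<bar>) \<le> 106 / 100"
proof -
  have "(\<Sum>n\<le>N. \<bar>beta_diff n\<bar>) \<le> \<bar>beta_diff 0\<bar> / (1 - (256 / 1000))"
    by (rule convolution_inverse_bounds(1)[OF cos_partial_0 cos_partial_beta_diff sum_cos_partial_le _
          sum_weighted_cos_partial_le]) simp_all
  \<comment> \<open>Here \<open>beta_diff 0\<close> is pi/4, and (pi/4)/0.744 is about
    1.056.\<close>
  also have "\<dots> \<le> 106 / 100"
    using pi_approx by (simp add: beta_diff_def beta_ratio_0)
  finally show ?thesis .
qed

lemma sum_weighted_abs_beta_diff_le: "(\<Sum>n\<le>N. real n * \<bar>beta_diff n\<bar>) \<le> 4 / 10"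
proof -
  have "(\<Sum>n\<le>N. real n * \<bar>beta_diff n\<bar>) \<le> (281 / 1000) * \<bar>beta_diff 0\<bar> / (1 - (256 / 1000))\<^sup>2"
    by (rule convolution_inverse_bounds(2)[OF cos_partial_0 cos_partial_beta_diff sum_cos_partial_le _
          sum_weighted_cos_partial_le]) simp_all
  also have "\<dots> \<le> 4 / 10"
    using pi_approx by (simp add: beta_diff_def beta_ratio_0 power2_eq_square)
  finally show ?thesis .
qed

lemma abs_beta_ratio_le: "\<bar>beta_ratio n\<bar> \<le> 106 / 100"
  unfolding beta_ratio_eq_sum by (rule order.trans[OF sum_abs sum_abs_beta_diff_le])

text \<open>The start at 1 matters, since b_0 = pi/4 is below 0.95. In the recursion p_1 <= -0.23,
  so the term with p_1 raises the value: b_(n+1) is at least about 0.785 + 0.23 * 0.95 - 0.0222 *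
  1.06, which is about 0.98.\<close>

lemma beta_ratio_ge:
  assumes "n \<ge> 1"
  shows "beta_ratio n \<ge> 95 / 100"
  using assms
proof (induction n rule: nat_induct_at_least)
  case base
  have "beta_ratio 1 = pi / 4 * ((pi / 2)\<^sup>2 / 2)"
    using cos_partial_beta_ratio[of 1]
    by (simp add: cos_partial_0 cos_partial_1[simplified] beta_ratio_0 algebra_simps)
  also have "\<dots> \<ge> (785 / 1000) * ((24649 / 10000) / 2)"
    using pi_approx pi_half_squared_ge by (intro mult_mono) auto
  finally show ?case by simp
next
  case (Suc n)
  let ?f = "\<lambda>i. cos_partial i * beta_ratio (Suc n - i)"
  have "{..Suc n} = insert 0 (insert 1 {2..Suc n})"
    by auto
  then have eq: "pi / 4 = beta_ratio (Suc n) + cos_partial 1 * beta_ratio n + (\<Sum>i=2..Suc n. ?f i)"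
    using cos_partial_beta_ratio[of "Suc n"] by (simp add: cos_partial_0)
  have "(\<Sum>i=2..Suc n. ?f i) \<le> (\<Sum>i=2..Suc n. \<bar>cos_partial i\<bar> * (106 / 100))"
  proof (rule sum_mono)
    fix i
    have "?f i \<le> \<bar>cos_partial i\<bar> * \<bar>beta_ratio (Suc n - i)\<bar>"
      by (metis abs_ge_self abs_mult)
    also have "\<dots> \<le> \<bar>cos_partial i\<bar> * (106 / 100)"
      by (intro mult_left_mono abs_beta_ratio_le) simp
    finally show "?f i \<le> \<bar>cos_partial i\<bar> * (106 / 100)" .
  qed
  also have "\<dots> \<le> (222 / 10000) * (106 / 100)"
    unfolding sum_distrib_right[symmetric] by (intro mult_right_mono sum_cos_partial_tail_le) simp
  finally have "(\<Sum>i=2..Suc n. ?f i) \<le> (222 / 10000) * (106 / 100)" .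
  moreover have "(23 / 100) * (95 / 100) \<le> (- cos_partial 1) * beta_ratio n"
    using Suc pi_half_squared_ge by (intro mult_mono) (auto simp: cos_partial_1[simplified])
  ultimately show ?case
    using eq pi_approx by simp
qed

text \<open>Each difference telescopes into the d_i with j < i <= k. After exchanging the sums,
  |d_i| is counted once for each j < i, which produces the weight i.\<close>

lemma sum_abs_beta_ratio_diff_le: "(\<Sum>j=0..k. \<bar>beta_ratio k - beta_ratio j\<bar>) \<le> 4 / 10"
proof -
  have "(\<Sum>j=0..k. \<bar>beta_ratio k - beta_ratio j\<bar>) \<le> (\<Sum>j=0..k. \<Sum>i | i \<in> {..k} \<and> j < i. \<bar>beta_diff i\<bar>)"
  proof (intro sum_mono)
    fix j assume "j \<in> {0..k}"
    then have "{..k} = {..j} \<union> {i. i \<in> {..k} \<and> j < i}"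
      by auto
    then have "beta_ratio k = (\<Sum>i\<in>{..j} \<union> {i. i \<in> {..k} \<and> j < i}. beta_diff i)"
      by (simp only: beta_ratio_eq_sum)
    also have "\<dots> = beta_ratio j + (\<Sum>i | i \<in> {..k} \<and> j < i. beta_diff i)"
      by (subst sum.union_disjoint) (auto simp: beta_ratio_eq_sum)
    finally show "\<bar>beta_ratio k - beta_ratio j\<bar> \<le> (\<Sum>i | i \<in> {..k} \<and> j < i. \<bar>beta_diff i\<bar>)"
      by simp
  qed
  also have "\<dots> = (\<Sum>i\<in>{..k}. \<Sum>j | j \<in> {0..k} \<and> j < i. \<bar>beta_diff i\<bar>)"
    by (rule sum.swap_restrict) auto
  also have "\<dots> = (\<Sum>i\<le>k. real i * \<bar>beta_diff i\<bar>)"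
  proof (intro sum.cong refl)
    fix i assume "i \<in> {..k}"
    then have "{j. j \<in> {0..k} \<and> j < i} = {..<i}"
      by auto
    then show "(\<Sum>j | j \<in> {0..k} \<and> j < i. \<bar>beta_diff i\<bar>) = real i * \<bar>beta_diff i\<bar>"
      by simp
  qed
  also have "\<dots> \<le> 4 / 10"
    by (rule sum_weighted_abs_beta_diff_le)
  finally show ?thesis .
qed

lemma sum_abs_beta_product_less:
  assumes "k \<ge> 1"
  shows "(\<Sum>j=0..k. \<bar>(beta_ratio k)\<^sup>2 - beta_ratio j * beta_ratio (k - j)\<bar>) < (beta_ratio k)\<^sup>2"
proof -
  let ?L = "beta_ratio k"
  have L: "?L \<ge> 95 / 100"
    using assms by (rule beta_ratio_ge)
  have "(\<Sum>j=0..k. \<bar>?L\<^sup>2 - beta_ratio j * beta_ratio (k - j)\<bar>)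
      \<le> (\<Sum>j=0..k. ?L * \<bar>?L - beta_ratio (k - j)\<bar> + (106 / 100) * \<bar>?L - beta_ratio j\<bar>)"
  proof (intro sum_mono)
    fix j
    \<comment> \<open>Replacing one factor at a time reduces the product to single differences, each
      family of which sums to at most 0.4.\<close>
    have "?L\<^sup>2 - beta_ratio j * beta_ratio (k - j)
        = ?L * (?L - beta_ratio (k - j)) + beta_ratio (k - j) * (?L - beta_ratio j)"
      by (simp add: power2_eq_square algebra_simps)
    also have "\<bar>\<dots>\<bar> \<le> ?L * \<bar>?L - beta_ratio (k - j)\<bar> + \<bar>beta_ratio (k - j)\<bar> * \<bar>?L - beta_ratio j\<bar>"
      using L by (intro order.trans[OF abs_triangle_ineq]) (simp add: abs_mult)
    also have "\<dots> \<le> ?L * \<bar>?L - beta_ratio (k - j)\<bar> + (106 / 100) * \<bar>?L - beta_ratio j\<bar>"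
      by (intro add_left_mono mult_right_mono abs_beta_ratio_le) simp
    finally show "\<bar>?L\<^sup>2 - beta_ratio j * beta_ratio (k - j)\<bar>
        \<le> ?L * \<bar>?L - beta_ratio (k - j)\<bar> + (106 / 100) * \<bar>?L - beta_ratio j\<bar>" .
  qed
  also have "\<dots> = ?L * (\<Sum>j=0..k. \<bar>?L - beta_ratio (k - j)\<bar>) + (106 / 100) * (\<Sum>j=0..k. \<bar>?L - beta_ratio j\<bar>)"
    by (simp add: sum.distrib sum_distrib_left)
  also have "(\<Sum>j=0..k. \<bar>?L - beta_ratio (k - j)\<bar>) = (\<Sum>j=0..k. \<bar>?L - beta_ratio j\<bar>)"
    by (rule sum.atLeastAtMost_rev[of _ 0 k, simplified, symmetric])
  also have "?L * (\<Sum>j=0..k. \<bar>?L - beta_ratio j\<bar>) + (106 / 100) * (\<Sum>j=0..k. \<bar>?L - beta_ratio j\<bar>)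
      \<le> ?L * (4 / 10) + (106 / 100) * (4 / 10)"
    using L by (intro add_mono mult_left_mono sum_abs_beta_ratio_diff_le) auto
  \<comment> \<open>This amounts to 0.424 < 0.55 b_k, which b_k >= 0.95 guarantees.\<close>
  also have "\<dots> < ?L * (95 / 100)"
    using L by simp
  also have "\<dots> \<le> ?L\<^sup>2"
    unfolding power2_eq_square using L by (intro mult_left_mono) auto
  finally show ?thesis .
qed

section \<open>Return to the Euler number polynomial\<close>

lemma euler_product_eq_beta_product:
  assumes "j \<le> k"
  shows "euler_number (2 * j) * euler_number (2 * k - 2 * j) * real ((2 * k) choose (2 * j))
    = (-1) ^ k * fact (2 * k) * (4 / pi)\<^sup>2 / (pi / 2) ^ (2 * k) * (beta_ratio j * beta_ratio (k - j))"
proof -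
  obtain m where m: "k = j + m"
    using assms by (auto simp: le_iff_add)
  have "real ((2 * k) choose (2 * j)) = fact (2 * k) / (fact (2 * j) * fact (2 * m))"
    using binomial_fact[of "2 * j" "2 * k", where 'a = real] by (simp add: m)
  then show ?thesis
    by (simp add: m beta_ratio_def power_add distrib_left field_simps power2_eq_square)
qed

theorem theorem1:
  fixes k :: nat
  assumes "k \<ge> 1"
  shows "\<forall>z::complex. poly (S_poly k) z = 0 \<longrightarrow> cmod z = 1 \<and> order z (S_poly k) = 1"
proof (intro allI impI)
  fix z :: complex
  assume z: "poly (S_poly k) z = 0"
  define c where "c j = euler_number (2 * j) * euler_number (2 * k - 2 * j) * real ((2 * k) choose (2 * j))" for j
  define M where "M = (-1) ^ k * fact (2 * k) * (4 / pi)\<^sup>2 / (pi / 2) ^ (2 * k)"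
  have c: "c j = M * (beta_ratio j * beta_ratio (k - j))" if "j \<le> k" for j
    unfolding c_def M_def by (rule euler_product_eq_beta_product[OF that])
  have S: "S_poly k = (\<Sum>j=0..k. monom (complex_of_real (c j)) j)"
    by (simp add: S_poly_def c_def)
  have "M \<noteq> 0"
    by (simp add: M_def)
  \<comment> \<open>The smallness condition is homogeneous, so it survives scaling by
    \<open>M\<close>. The sign of \<open>M\<close> alternates with k, which is why the criterion
    compares with |C|.\<close>
  have "(\<Sum>j=0..k. \<bar>M * (beta_ratio k)\<^sup>2 - c j\<bar>)
      = \<bar>M\<bar> * (\<Sum>j=0..k. \<bar>(beta_ratio k)\<^sup>2 - beta_ratio j * beta_ratio (k - j)\<bar>)"
    unfolding sum_distrib_left
    by (intro sum.cong) (auto simp: c simp flip: abs_mult right_diff_distrib)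
  also have "\<dots> < \<bar>M\<bar> * (beta_ratio k)\<^sup>2"
    using \<open>M \<noteq> 0\<close> sum_abs_beta_product_less[OF assms] by (intro mult_strict_left_mono) auto
  finally have "(\<Sum>j=0..k. \<bar>M * (beta_ratio k)\<^sup>2 - c j\<bar>) < \<bar>M * (beta_ratio k)\<^sup>2\<bar>"
    by (simp add: abs_mult)
  moreover have "c (k - j) = c j" if "j \<le> k" for j
    using that by (simp add: c mult.commute)
  ultimately show "cmod z = 1 \<and> order z (S_poly k) = 1"
    using self_reciprocal_roots_on_circle[of k c "M * (beta_ratio k)\<^sup>2" z] z unfolding S by blast
qed

end
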